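(* Let $N\ge 5$ and let $A\in M_N(\mathbb{R})$ be the circulant matrix generated by $a=(a_0,\dots,a_{N-1})\in\mathbb{R}^N$. Set $\phi_j=\frac{2\pi j}{N}$ and assume that $A$ satisfies the cone condition $$\sum_{l=1}^{N-1}a_l\cos(\phi_l)\bigl(1-\cos(k\phi_l)\bigr)>0\qquad\text{for all }k\in\{1,\dots,N-1\}.$$ Then for every $c\in\mathbb{S}$, the rotational twisted state $$\theta_j(t)=\phi_j+\omega t+c,\qquad j\in\{1,\dots,N\},\qquad \omega=\sum_{l=1}^{N-1}a_l\sin(\phi_l),$$ is linearly stable for the Kuramoto model $$\frac{d}{dt}\theta_j=\sum_{l=1}^N A_{jl}\sin(\theta_l-\theta_j),\qquad j\in\{1,\dots,N\}.$$
   Context: $\mathbb{S}=\mathbb{R}/2\pi\mathbb{Z}$. A matrix $A\in M_N(\mathbb{R})$ is circulant, generated by $a=(a_0,\dots,a_{N-1})$, if $A_{jl}=a_{(l-j)\bmod N}$ for all $j,l\in\{1,\dots,N\}$, where the remainder is taken in $\{0,\dots,N-1\}$ (symmetry and sign of the entries are not assumed). Linear stability of the rotational twisted state: in the co-rotating frame the system reads $\frac{d}{dt}\theta_j=-\omega+\sum_{l}A_{jl}\sin(\theta_l-\theta_j)$, for which $\theta_j=\phi_j+c$ is a fixed point. The state is linearly stable if the $N\times N$ Jacobian of the right-hand side at this fixed point has $0$ as a simple eigenvalue (due to invariance under global rotation, i.e. under $c$) and all its other $N-1$ eigenvalues have strictly negative real part. *)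

theory Defs
  imports "HOL-Analysis.Analysis" "Jordan_Normal_Form.Char_Poly"
begin

(* Matrices and vectors of Jordan_Normal_Form are indexed from 0, whereas oscillators carry
   the labels 1, ..., N; hence the entry A_jl is A $$ (j - 1, l - 1).  The generating vector
   (a_0, ..., a_(N-1)) is indexed from 0 as it stands. *)

definition circulant_generated_by :: "nat \<Rightarrow> real vec \<Rightarrow> real mat \<Rightarrow> bool" where
  "circulant_generated_by N a A \<longleftrightarrow>
     a \<in> carrier_vec N \<and> A \<in> carrier_mat N N \<and>
     (\<forall>j\<in>{1..N}. \<forall>l\<in>{1..N}. A $$ (j - 1, l - 1) = a $ nat ((int l - int j) mod int N))"

(* Phases are represented by real lifts of points of the circle.  The coordinates of a
   configuration outside {1..N} are irrelevant. *)

definition kuramoto_field :: "nat \<Rightarrow> real mat \<Rightarrow> (nat \<Rightarrow> real) \<Rightarrow> nat \<Rightarrow> real" where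
  "kuramoto_field N A \<theta> j = (\<Sum>l = 1..N. A $$ (j - 1, l - 1) * sin (\<theta> l - \<theta> j))"

definition solves_kuramoto :: "nat \<Rightarrow> real mat \<Rightarrow> (real \<Rightarrow> nat \<Rightarrow> real) \<Rightarrow> bool" where
  "solves_kuramoto N A \<theta> \<longleftrightarrow>
     (\<forall>t. \<forall>j\<in>{1..N}. ((\<lambda>s. \<theta> s j) has_real_derivative kuramoto_field N A (\<theta> t) j) (at t))"

definition corotating_field :: "nat \<Rightarrow> real mat \<Rightarrow> real \<Rightarrow> (nat \<Rightarrow> real) \<Rightarrow> nat \<Rightarrow> real" where
  "corotating_field N A \<omega> \<theta> j = - \<omega> + kuramoto_field N A \<theta> j"

(* Matrix of partial derivatives of a vector field F on R^N with coordinates 1, ..., N;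
   meaningful only where these partial derivatives exist. *)

definition jacobian :: "nat \<Rightarrow> ((nat \<Rightarrow> real) \<Rightarrow> nat \<Rightarrow> real) \<Rightarrow> (nat \<Rightarrow> real) \<Rightarrow> real mat" where
  "jacobian N F \<theta> =
     mat N N (\<lambda>(r, s). deriv (\<lambda>x. F (\<theta>(Suc s := x)) (Suc r)) (\<theta> (Suc s)))"

(* Eigenvalues are taken over the complex numbers, and a simple eigenvalue is one of algebraic
   multiplicity 1.  Since 0 is simple, the remaining N - 1 eigenvalues, counted with
   multiplicity, are exactly the nonzero ones. *)

definition linearly_stable_mod_rotation ::
    "nat \<Rightarrow> ((nat \<Rightarrow> real) \<Rightarrow> nat \<Rightarrow> real) \<Rightarrow> (nat \<Rightarrow> real) \<Rightarrow> bool" where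
  "linearly_stable_mod_rotation N F \<theta> \<longleftrightarrow>
     (\<forall>j\<in>{1..N}. F \<theta> j = 0) \<and>
     (let J = map_mat complex_of_real (jacobian N F \<theta>) in
        Polynomial.order 0 (char_poly J) = 1 \<and>
        (\<forall>z. eigenvalue J z \<and> z \<noteq> 0 \<longrightarrow> Re z < 0))"

end

theory Submission
  imports Defs
begin

text \<open>
  The Jacobian of the co-rotating field at a configuration \<open>\<theta>\<close> acts on a vector \<open>v\<close> like a weighted
  graph Laplacian: row \<open>j\<close> gives \<open>\<Sum>l. A_jl cos (\<theta>_l - \<theta>_j) (v_l - v_j)\<close>. At the twisted state both
  \<open>A_jl\<close> and \<open>\<theta>_l - \<theta>_j\<close> depend only on \<open>l - j\<close> modulo \<open>N\<close>, so this operator commutes with cyclic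
  shifts and the characters \<open>v_l = exp (2 \<pi> \<i> k l / N)\<close> of the cyclic group are eigenvectors, with
  eigenvalues \<open>\<mu>_k = \<Sum>m. a_m cos \<phi>_m (exp (\<i> k \<phi>_m) - 1)\<close>.

  The characters are orthogonal, hence form a basis, and the characteristic polynomial is the product
  of the factors \<open>x - \<mu>_k\<close> (\<open>char_poly_eq_prod_of_characters\<close>); this controls algebraic
  multiplicities and not only the set of eigenvalues. Now \<open>\<mu>_0 = 0\<close>, while for \<open>0 < k < N\<close> the real
  part of \<open>\<mu>_k\<close> is minus the \<open>k\<close>-th sum of the cone condition, so it is negative. In particular no
  other \<open>\<mu>_k\<close> vanishes and \<open>0\<close> is a simple eigenvalue.
\<close>

section \<open>Characters of the cyclic group\<close>

definition cyclic_char :: "nat \<Rightarrow> int \<Rightarrow> complex" where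
  "cyclic_char N i = cis (2 * pi * of_int i / real N)"

lemma cyclic_char_0 [simp]: "cyclic_char N 0 = 1"
  by (simp add: cyclic_char_def)

lemma cyclic_char_add: "cyclic_char N (i + j) = cyclic_char N i * cyclic_char N j"
  by (simp add: cyclic_char_def cis_mult add_divide_distrib distrib_left)

lemma cyclic_char_power: "cyclic_char N i ^ n = cyclic_char N (int n * i)"
  by (simp add: cyclic_char_def Complex.DeMoivre mult_ac)

lemma cyclic_char_eq_1_iff:
  assumes "N > 0"
  shows "cyclic_char N i = 1 \<longleftrightarrow> int N dvd i"
proof
  assume "cyclic_char N i = 1"
  then have "cos (2 * pi * of_int i / real N) = 1"
    by (metis Re_complex_of_real cis.simps(1) cyclic_char_def of_real_1)
  then obtain n :: int where "2 * pi * of_int i / real N = of_int n * 2 * pi"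
    by (auto simp: cos_one_2pi_int)
  then have "real_of_int i = of_int (n * int N)"
    using assms by (simp add: field_simps)
  then have "i = n * int N"
    by (simp only: of_int_eq_iff)
  then show "int N dvd i" by simp
next
  assume "int N dvd i"
  then obtain n where n: "i = int N * n" by (auto elim: dvdE)
  have "2 * pi * of_int i / real N = 2 * pi * of_int n"
    using assms by (simp add: n)
  then show "cyclic_char N i = 1"
    by (simp add: cyclic_char_def cis_multiple_2pi)
qed

lemma cyclic_char_cong:
  assumes "N > 0" "i mod int N = j mod int N"
  shows "cyclic_char N i = cyclic_char N j"
proof -
  have "cyclic_char N (i - j) = 1"
    using assms by (simp add: cyclic_char_eq_1_iff mod_eq_dvd_iff)
  then show ?thesis
    using cyclic_char_add[of N "i - j" j] by simp
qed

lemma sum_cyclic_char: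
  assumes "N > 0" "\<not> int N dvd d"
  shows "(\<Sum>k<N. cyclic_char N (int k * d)) = 0"
proof -
  have "(\<Sum>k<N. cyclic_char N (int k * d)) = (\<Sum>k<N. cyclic_char N d ^ k)"
    by (simp add: cyclic_char_power)
  also have "\<dots> = (cyclic_char N d ^ N - 1) / (cyclic_char N d - 1)"
    using assms by (intro geometric_sum) (simp add: cyclic_char_eq_1_iff)
  also have "cyclic_char N d ^ N = 1"
    using assms by (simp add: cyclic_char_power cyclic_char_eq_1_iff)
  finally show ?thesis by simp
qed

lemma cyclic_char_orthogonal:
  assumes "r < N" "s < N"
  shows "(\<Sum>k<N. cyclic_char N (int k * int r) * cyclic_char N (- (int k * int s)))
    = (if r = s then of_nat N else 0)"
proof -
  have *: "int N dvd int r - int s \<longleftrightarrow> r = s"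
    using assms by (auto simp flip: mod_eq_dvd_iff)
  have "(\<Sum>k<N. cyclic_char N (int k * int r) * cyclic_char N (- (int k * int s)))
      = (\<Sum>k<N. cyclic_char N (int k * (int r - int s)))"
    by (simp add: algebra_simps flip: cyclic_char_add)
  also have "\<dots> = (if r = s then of_nat N else 0)"
    using sum_cyclic_char[of N "int r - int s"] assms * by auto
  finally show ?thesis .
qed

section \<open>Circulant sums and matrices\<close>

lemma sum_shift_mod:
  assumes "N > 0"
  shows "(\<Sum>s<N. h (nat ((int s - j) mod int N))) = (\<Sum>m<N. h m)"
proof (rule sum.reindex_bij_witness[where i = "\<lambda>m. nat ((int m + j) mod int N)"
      and j = "\<lambda>s. nat ((int s - j) mod int N)"])
qed (use assms in \<open>auto simp: nat_less_iff mod_simps\<close>)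

text \<open>
  Orthogonality makes the matrix \<open>P\<close> whose columns are the characters invertible, with inverse its
  conjugate transpose divided by \<open>N\<close>. Conjugation by \<open>P\<close> turns a matrix that has all characters as
  eigenvectors into a diagonal one, even when some of the \<open>\<mu> k\<close> coincide.
\<close>

lemma char_poly_eq_prod_of_characters:
  fixes J :: "complex mat"
  assumes J: "J \<in> carrier_mat N N"
    and eig: "\<And>k r. k < N \<Longrightarrow> r < N \<Longrightarrow>
      (\<Sum>s<N. J $$ (r, s) * cyclic_char N (int k * int s)) = \<mu> k * cyclic_char N (int k * int r)"
  shows "char_poly J = (\<Prod>k<N. [:- \<mu> k, 1:])"
proof -
  define P where "P = mat N N (\<lambda>(r, k). cyclic_char N (int k * int r))"
  define Q where "Q = mat N N (\<lambda>(k, s). cyclic_char N (- (int k * int s)) / of_nat N)"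
  define D where "D = mat_diag N \<mu>"
  have carr: "P \<in> carrier_mat N N" "Q \<in> carrier_mat N N" "D \<in> carrier_mat N N"
    by (simp_all add: P_def Q_def D_def mat_diag_def)
  have PQ: "P * Q = 1\<^sub>m N"
  proof (rule eq_matI)
    fix r s assume "r < dim_row (1\<^sub>m N :: complex mat)" "s < dim_col (1\<^sub>m N :: complex mat)"
    then have rs: "r < N" "s < N" by auto
    then have "(P * Q) $$ (r, s)
        = (\<Sum>k<N. cyclic_char N (int k * int r) * cyclic_char N (- (int k * int s))) / of_nat N"
      by (simp add: P_def Q_def scalar_prod_def sum_divide_distrib lessThan_atLeast0)
    also have "\<dots> = 1\<^sub>m N $$ (r, s)"
      using rs cyclic_char_orthogonal[OF rs] by auto
    finally show "(P * Q) $$ (r, s) = 1\<^sub>m N $$ (r, s)" .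
  qed (simp_all add: P_def Q_def)
  have QP: "Q * P = 1\<^sub>m N"
    by (rule mat_mult_left_right_inverse[OF carr(1,2) PQ])
  have JP: "J * P = P * D"
  proof (rule eq_matI)
    fix r k assume "r < dim_row (P * D)" "k < dim_col (P * D)"
    then have rk: "r < N" "k < N" using carr by auto
    have "(J * P) $$ (r, k) = (\<Sum>s<N. J $$ (r, s) * cyclic_char N (int k * int s))"
      using rk J by (simp add: P_def scalar_prod_def lessThan_atLeast0)
    also have "\<dots> = (P * D) $$ (r, k)"
      unfolding D_def mat_diag_mult_right[OF carr(1)] using rk by (simp add: eig P_def)
    finally show "(J * P) $$ (r, k) = (P * D) $$ (r, k)" .
  qed (use carr J in auto)
  have "J = J * (P * Q)"
    using J by (simp add: PQ)
  also have "\<dots> = P * D * Q"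
    using J carr by (simp add: JP flip: assoc_mult_mat[of J N N P N Q N])
  finally have "similar_mat J D"
    using similar_mat_witI[OF PQ QP _ J carr(3,1,2)] unfolding similar_mat_def by blast
  then have "char_poly J = char_poly D"
    by (rule char_poly_similar)
  also have "\<dots> = (\<Prod>d\<leftarrow>diag_mat D. [:- d, 1:])"
    by (rule char_poly_upper_triangular[OF carr(3)]) (auto simp: D_def mat_diag_def)
  also have "\<dots> = (\<Prod>k\<leftarrow>[0..<N]. [:- \<mu> k, 1:])"
    by (rule arg_cong[where f = prod_list])
      (auto simp: diag_mat_def D_def mat_diag_def)
  also have "\<dots> = (\<Prod>k<N. [:- \<mu> k, 1:])"
    by (simp add: prod.distinct_set_conv_list[symmetric] lessThan_atLeast0)
  finally show ?thesis .
qed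

lemma order_prod_linear_factors_eq_1:
  fixes \<mu> :: "nat \<Rightarrow> complex"
  assumes "N > 0" "\<mu> 0 = 0" "\<And>k. k \<in> {1..<N} \<Longrightarrow> \<mu> k \<noteq> 0"
  shows "Polynomial.order 0 (\<Prod>k<N. [:- \<mu> k, 1:]) = 1"
proof -
  let ?R = "\<Prod>k\<in>{1..<N}. [:- \<mu> k, 1:]"
  have split: "(\<Prod>k<N. [:- \<mu> k, 1:]) = [:- 0, 1:] * ?R"
    using assms(1,2) by (simp add: lessThan_atLeast0 prod.atLeast_Suc_lessThan)
  have "poly ?R 0 \<noteq> 0"
    using assms(3) by (simp add: poly_prod)
  then have "Polynomial.order 0 ?R = 0" and "?R \<noteq> 0"
    by (auto intro: order_0I)
  then show ?thesis
    unfolding split using order_power_n_n[of "0::complex" 1]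
    by (subst order_mult) (simp_all)
qed

section \<open>The Kuramoto field at a twisted state\<close>

text \<open>
  The two Kronecker deltas come from the two occurrences of the phase in \<open>\<theta> l - \<theta> j\<close>; they cancel
  at \<open>l = j\<close>, so the diagonal entry needs no separate treatment.
\<close>

lemma jacobian_corotating_field:
  assumes "r < N" "s < N"
  shows "jacobian N (corotating_field N A \<omega>) \<theta> $$ (r, s)
    = (\<Sum>l<N. A $$ (r, l) * cos (\<theta> (Suc l) - \<theta> (Suc r)) *
        (of_bool (l = s) - of_bool (r = s)))"
proof -
  have upd: "((\<lambda>x. (\<theta>(i := x)) l) has_real_derivative of_bool (l = i)) (at y)" for i l y
    by (cases "l = i") auto
  have "((\<lambda>x. corotating_field N A \<omega> (\<theta>(Suc s := x)) (Suc r)) has_real_derivative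
      0 + (\<Sum>l = 1..N. A $$ (r, l - 1) *
        (cos ((\<theta>(Suc s := \<theta> (Suc s))) l - (\<theta>(Suc s := \<theta> (Suc s))) (Suc r)) *
        (of_bool (l = Suc s) - of_bool (Suc r = Suc s))))) (at (\<theta> (Suc s)))"
    \<comment> \<open>The summand \<open>0\<close> is the derivative of the constant \<open>- \<omega>\<close>.\<close>
    unfolding corotating_field_def kuramoto_field_def diff_Suc_1
    by (intro DERIV_add DERIV_const DERIV_sum DERIV_cmult DERIV_chain'[OF _ DERIV_sin] DERIV_diff upd)
  then have "deriv (\<lambda>x. corotating_field N A \<omega> (\<theta>(Suc s := x)) (Suc r)) (\<theta> (Suc s))
      = (\<Sum>l = 1..N. A $$ (r, l - 1) * (cos (\<theta> l - \<theta> (Suc r)) *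
          (of_bool (l = Suc s) - of_bool (r = s))))"
    by (simp add: DERIV_imp_deriv)
  also have "\<dots> = (\<Sum>l<N. A $$ (r, l) * cos (\<theta> (Suc l) - \<theta> (Suc r)) *
        (of_bool (l = s) - of_bool (r = s)))"
    by (simp add: sum.atLeast1_atMost_eq mult.assoc)
  finally show ?thesis
    using assms by (simp add: jacobian_def)
qed

text \<open>
  This is the weighted Laplacian form of the linearisation: constant vectors are visibly in the kernel,
  which is the rotational invariance of the model.
\<close>

lemma jacobian_corotating_field_mult:
  fixes v :: "nat \<Rightarrow> complex"
  assumes "r < N"
  shows "(\<Sum>s<N. of_real (jacobian N (corotating_field N A \<omega>) \<theta> $$ (r, s)) * v s)
    = (\<Sum>l<N. of_real (A $$ (r, l) * cos (\<theta> (Suc l) - \<theta> (Suc r))) * (v l - v r))"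
proof -
  let ?w = "\<lambda>l. complex_of_real (A $$ (r, l) * cos (\<theta> (Suc l) - \<theta> (Suc r)))"
  have "(\<Sum>s<N. of_real (jacobian N (corotating_field N A \<omega>) \<theta> $$ (r, s)) * v s)
      = (\<Sum>s<N. \<Sum>l<N. ?w l * (of_bool (l = s) * v s - of_bool (r = s) * v s))"
  proof (rule sum.cong[OF refl])
    fix s assume "s \<in> {..<N}"
    then have s: "s < N" by simp
    show "of_real (jacobian N (corotating_field N A \<omega>) \<theta> $$ (r, s)) * v s
        = (\<Sum>l<N. ?w l * (of_bool (l = s) * v s - of_bool (r = s) * v s))"
      unfolding jacobian_corotating_field[OF assms s] of_real_sum sum_distrib_right
      by (rule sum.cong) (auto simp: of_bool_def)
  qed
  also have "\<dots> = (\<Sum>l<N. \<Sum>s<N. ?w l * (of_bool (l = s) * v s - of_bool (r = s) * v s))"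
    by (rule sum.swap)
  also have "\<dots> = (\<Sum>l<N. ?w l * (v l - v r))"
  proof (rule sum.cong[OF refl])
    fix l assume "l \<in> {..<N}"
    have delta: "(\<Sum>s<N. of_bool (i = s) * v s) = v i" if "i < N" for i
      using that by (simp add: of_bool_def if_distrib[of "\<lambda>x. x * _"] sum.delta' cong: if_cong)
    show "(\<Sum>s<N. ?w l * (of_bool (l = s) * v s - of_bool (r = s) * v s)) = ?w l * (v l - v r)"
      using \<open>l \<in> {..<N}\<close> assms
      by (simp only: sum_distrib_left[symmetric] sum_subtractf delta lessThan_iff)
  qed
  finally show ?thesis .
qed

lemma circulant_generated_byD:
  assumes "circulant_generated_by N a A" "r < N" "l < N"
  shows "A $$ (r, l) = vec_index a (nat ((int l - int r) mod int N))"
proof -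
  have "Suc r \<in> {1..N}" "Suc l \<in> {1..N}"
    using assms(2,3) by auto
  then have "A $$ (Suc r - 1, Suc l - 1)
      = vec_index a (nat ((int (Suc l) - int (Suc r)) mod int N))"
    using assms(1) unfolding circulant_generated_by_def by blast
  then show ?thesis by simp
qed

text \<open>
  Phase differences of the twisted state are again phases up to full turns. This makes the coupling
  terms \<open>A_jl sin (\<phi>_l - \<phi>_j)\<close> and \<open>A_jl cos (\<phi>_l - \<phi>_j)\<close> functions of the residue of \<open>l - j\<close>, so that
  the sums over \<open>l\<close> can be shifted by \<open>sum_shift_mod\<close>.
\<close>

lemma cis_phase_diff:
  assumes "N > 0" and \<phi>: "\<And>j. \<phi> j = 2 * pi * real j / real N"
  shows "cis (\<phi> l - \<phi> j) = cis (\<phi> (nat ((int l - int j) mod int N)))"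
proof -
  have "cis (\<phi> l - \<phi> j) = cyclic_char N (int l - int j)"
    by (simp add: \<phi> cyclic_char_def diff_divide_distrib right_diff_distrib)
  also have "\<dots> = cyclic_char N ((int l - int j) mod int N)"
    using assms(1) by (intro cyclic_char_cong) auto
  also have "\<dots> = cis (\<phi> (nat ((int l - int j) mod int N)))"
    using assms(1) by (simp add: \<phi> cyclic_char_def)
  finally show ?thesis .
qed

lemma kuramoto_field_twisted_state:
  assumes "N > 0" and circ: "circulant_generated_by N a A"
    and \<phi>: "\<And>j. \<phi> j = 2 * pi * real j / real N"
    and j: "j \<in> {1..N}"
  shows "kuramoto_field N A (\<lambda>j. \<phi> j + d) j = (\<Sum>m = 1..N - 1. vec_index a m * sin (\<phi> m))"
proof -
  obtain r where r: "j = Suc r" "r < N"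
    using j by (cases j) auto
  have sin: "sin (\<phi> (Suc l) - \<phi> (Suc r)) = sin (\<phi> (nat ((int l - int r) mod int N)))" for l
    using arg_cong[OF cis_phase_diff[OF assms(1) \<phi>, of "Suc l" "Suc r"], of Im] by simp
  have "kuramoto_field N A (\<lambda>j. \<phi> j + d) j
      = (\<Sum>l<N. A $$ (r, l) * sin (\<phi> (Suc l) - \<phi> (Suc r)))"
    by (simp add: kuramoto_field_def sum.atLeast1_atMost_eq r)
  also have "\<dots> = (\<Sum>l<N. (\<lambda>m. vec_index a m * sin (\<phi> m)) (nat ((int l - int r) mod int N)))"
    by (intro sum.cong) (simp_all add: circulant_generated_byD[OF circ] r sin)
  also have "\<dots> = (\<Sum>m<N. vec_index a m * sin (\<phi> m))"
    by (rule sum_shift_mod[OF assms(1)])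
  \<comment> \<open>The self-coupling \<open>a_0\<close> drops out because \<open>sin \<phi>_0 = 0\<close>.\<close>
  also have "\<dots> = (\<Sum>m = 1..N - 1. vec_index a m * sin (\<phi> m))"
    by (rule sum.mono_neutral_right) (auto simp: \<phi> not_le)
  finally show ?thesis .
qed

text \<open>
  These are the eigenvalues of the circulant matrix generated by \<open>a_m cos \<phi>_m\<close>, shifted by its row
  sum; the shift makes the term \<open>m = 0\<close> vanish, which is why the cone condition starts at \<open>l = 1\<close>.
\<close>

definition twisted_eigenvalue :: "nat \<Rightarrow> real vec \<Rightarrow> (nat \<Rightarrow> real) \<Rightarrow> nat \<Rightarrow> complex" where
  "twisted_eigenvalue N a \<phi> k =
     (\<Sum>m<N. of_real (vec_index a m * cos (\<phi> m)) * (cis (real k * \<phi> m) - 1))"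

lemma twisted_eigenvalue_0: "twisted_eigenvalue N a \<phi> 0 = 0"
  by (simp add: twisted_eigenvalue_def)

lemma Re_twisted_eigenvalue:
  assumes "\<phi> 0 = 0"
  shows "Re (twisted_eigenvalue N a \<phi> k)
    = - (\<Sum>m = 1..N - 1. vec_index a m * cos (\<phi> m) * (1 - cos (real k * \<phi> m)))"
proof -
  have "Re (twisted_eigenvalue N a \<phi> k)
      = (\<Sum>m<N. vec_index a m * cos (\<phi> m) * (cos (real k * \<phi> m) - 1))"
    by (simp add: twisted_eigenvalue_def)
  also have "\<dots> = (\<Sum>m = 1..N - 1. vec_index a m * cos (\<phi> m) * (cos (real k * \<phi> m) - 1))"
    by (rule sum.mono_neutral_right) (auto simp: assms not_le)
  finally show ?thesis
    by (simp add: right_diff_distrib flip: sum_negf)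
qed

text \<open>
  The Laplacian form involves differences of values of the character; multiplicativity factors them as
  \<open>\<chi> l - \<chi> r = (\<chi> (l - r) - 1) * \<chi> r\<close>, where the first factor depends only on the residue of \<open>l - r\<close>
  and the second does not depend on the summation index.
\<close>

lemma jacobian_twisted_state_character:
  assumes circ: "circulant_generated_by N a A"
    and \<phi>: "\<And>j. \<phi> j = 2 * pi * real j / real N"
    and r: "r < N"
  shows "(\<Sum>s<N. of_real (jacobian N (corotating_field N A \<omega>) (\<lambda>j. \<phi> j + c) $$ (r, s)) *
            cyclic_char N (int k * int s))
    = twisted_eigenvalue N a \<phi> k * cyclic_char N (int k * int r)"
proof -
  have N: "N > 0" using r by simp
  let ?m = "\<lambda>l. nat ((int l - int r) mod int N)"
  let ?h = "\<lambda>m. of_real (vec_index a m * cos (\<phi> m)) * (cis (real k * \<phi> m) - 1)"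
  have cos: "cos (\<phi> (Suc l) - \<phi> (Suc r)) = cos (\<phi> (?m l))" for l
    using arg_cong[OF cis_phase_diff[OF N \<phi>, of "Suc l" "Suc r"], of Re] by simp
  have char: "cyclic_char N (int k * int l) - cyclic_char N (int k * int r)
      = (cis (real k * \<phi> (?m l)) - 1) * cyclic_char N (int k * int r)" for l
  proof -
    have "cis (real k * \<phi> (?m l)) = cyclic_char N (int k * int (?m l))"
      by (simp add: cyclic_char_def \<phi> mult_ac)
    also have "\<dots> = cyclic_char N (int k * (int l - int r))"
      using N by (intro cyclic_char_cong) (auto simp: mod_simps)
    finally show ?thesis
      by (simp add: algebra_simps flip: cyclic_char_add)
  qed
  have "(\<Sum>s<N. of_real (jacobian N (corotating_field N A \<omega>) (\<lambda>j. \<phi> j + c) $$ (r, s)) *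
            cyclic_char N (int k * int s))
      = (\<Sum>l<N. ?h (?m l) * cyclic_char N (int k * int r))"
    unfolding jacobian_corotating_field_mult[OF r]
    by (intro sum.cong) (simp_all add: circulant_generated_byD[OF circ] r cos char)
  also have "\<dots> = (\<Sum>l<N. ?h (?m l)) * cyclic_char N (int k * int r)"
    by (simp only: sum_distrib_right)
  also have "(\<Sum>l<N. ?h (?m l)) = twisted_eigenvalue N a \<phi> k"
    unfolding twisted_eigenvalue_def by (rule sum_shift_mod[OF N])
  finally show ?thesis .
qed

theorem theorem1:
  fixes N :: nat and a :: "real vec" and A :: "real mat"
    and \<phi> :: "nat \<Rightarrow> real" and \<omega> c :: real
  assumes "N \<ge> 5"
    and "circulant_generated_by N a A"
    and "\<And>j. \<phi> j = 2 * pi * real j / real N"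
    and "\<And>k. k \<in> {1..N - 1} \<Longrightarrow>
           (\<Sum>l = 1..N - 1. a $ l * cos (\<phi> l) * (1 - cos (real k * \<phi> l))) > 0"
    and "\<omega> = (\<Sum>l = 1..N - 1. a $ l * sin (\<phi> l))"
  shows "solves_kuramoto N A (\<lambda>t j. \<phi> j + \<omega> * t + c) \<and>
         linearly_stable_mod_rotation N (corotating_field N A \<omega>) (\<lambda>j. \<phi> j + c)"
proof
  have N: "N > 0" using assms(1) by simp
  have field: "kuramoto_field N A (\<lambda>j. \<phi> j + d) j = \<omega>" if "j \<in> {1..N}" for d j
    using kuramoto_field_twisted_state[OF N assms(2,3) that] assms(5) by simp
  show "solves_kuramoto N A (\<lambda>t j. \<phi> j + \<omega> * t + c)"
    unfolding solves_kuramoto_def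
  proof (intro allI ballI)
    fix t j assume j: "j \<in> {1..N}"
    have "((\<lambda>s. \<phi> j + \<omega> * s + c) has_real_derivative \<omega>) (at t)"
      by (auto intro!: derivative_eq_intros)
    then show "((\<lambda>s. \<phi> j + \<omega> * s + c) has_real_derivative
        kuramoto_field N A (\<lambda>j. \<phi> j + \<omega> * t + c) j) (at t)"
      using field[OF j, of "\<omega> * t + c"] by (simp add: add.assoc)
  qed
  define J where
    "J = map_mat complex_of_real (jacobian N (corotating_field N A \<omega>) (\<lambda>j. \<phi> j + c))"
  define \<mu> where "\<mu> = twisted_eigenvalue N a \<phi>"
  have J: "J \<in> carrier_mat N N"
    by (simp add: J_def jacobian_def)
  have "J $$ (r, s) = of_real (jacobian N (corotating_field N A \<omega>) (\<lambda>j. \<phi> j + c) $$ (r, s))"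
    if "r < N" "s < N" for r s
    using that by (simp add: J_def jacobian_def)
  then have char_poly: "char_poly J = (\<Prod>k<N. [:- \<mu> k, 1:])"
    using jacobian_twisted_state_character[OF assms(2,3)] J
    by (intro char_poly_eq_prod_of_characters) (simp_all add: \<mu>_def)
  have \<mu>_0: "\<mu> 0 = 0"
    by (simp add: \<mu>_def twisted_eigenvalue_0)
  have Re_\<mu>: "Re (\<mu> k) < 0" if "k \<in> {1..<N}" for k
  proof -
    have "k \<in> {1..N - 1}" using that by auto
    from assms(4)[OF this] show ?thesis
      by (simp add: \<mu>_def Re_twisted_eigenvalue assms(3))
  qed
  have "Polynomial.order 0 (char_poly J) = 1"
    unfolding char_poly using N \<mu>_0 Re_\<mu>
    by (intro order_prod_linear_factors_eq_1) fastforce+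
  moreover have "Re z < 0" if z: "eigenvalue J z" "z \<noteq> 0" for z
  proof -
    have "poly (\<Prod>k<N. [:- \<mu> k, 1:]) z = 0"
      using z(1) eigenvalue_root_char_poly[OF J] by (simp add: char_poly)
    then obtain k where k: "k < N" "z = \<mu> k"
      by (auto simp: poly_prod)
    then have "k \<noteq> 0"
      using z(2) \<mu>_0 by metis
    then show "Re z < 0"
      using k Re_\<mu> by simp
  qed
  ultimately show "linearly_stable_mod_rotation N (corotating_field N A \<omega>) (\<lambda>j. \<phi> j + c)"
    by (simp add: linearly_stable_mod_rotation_def J_def[symmetric] corotating_field_def field)
qed

end
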